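(* For any non-complete graph $G$ with order $n$ and minimum degree $\delta\geq 1$ we have $$\mathrm{gp}(\mathcal{M}(G))\leq n+\max\{0,\ \mathrm{ip}_4(G)-\delta+1\}.$$
   Context: All graphs are simple, connected and finite. A set $S$ of vertices of a graph $H$ is a general position set if no shortest path in $H$ contains three or more vertices of $S$; $\mathrm{gp}(H)$ is the number of vertices in a largest general position set of $H$. The Mycielskian $\mathcal{M}(G)$ of a graph $G$ with vertex set $V$ and edge set $E$ has vertex set $V\cup V'\cup\{u^*\}$, where $V'=\{u' : u\in V\}$ is a disjoint copy of $V$ and $u^*$ is an additional vertex (the root), and edge set $E\cup\{uv' : uv\in E\}\cup\{v'u^* : v'\in V'\}$ (for each edge $uv\in E$ both $uv'$ and $vu'$ are included). An independent $4$-position set of $G$ is a subset $S\subseteq V(G)$ that is an independent set and such that no shortest path of $G$ of length at most $4$ passes through three or more vertices of $S$; $\mathrm{ip}_4(G)$ is the largest number of vertices in such a set. *)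

theory Defs
  imports "Graph_Theory.Graph_Theory"
begin

text \<open>
  Simple finite graphs are \<^const>\<open>pair_graph\<close>s: each edge \<open>uv\<close> is represented by the two arcs
  \<open>(u, v)\<close> and \<open>(v, u)\<close>, so the degree of a vertex is its out-degree.
\<close>

definition min_degree :: "('a, 'b) pre_digraph \<Rightarrow> nat" where
  "min_degree H = Min (out_degree H ` verts H)"

definition shortest_vpath :: "'a vwalk \<Rightarrow> ('a, 'b) pre_digraph \<Rightarrow> bool" where
  "shortest_vpath p H \<longleftrightarrow> vpath p H \<and>
     (\<forall>q. vpath q H \<and> hd q = hd p \<and> last q = last p \<longrightarrow> vwalk_length p \<le> vwalk_length q)"

definition general_position_set :: "('a, 'b) pre_digraph \<Rightarrow> 'a set \<Rightarrow> bool" where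
  "general_position_set H S \<longleftrightarrow> S \<subseteq> verts H \<and>
     \<not> (\<exists>p. shortest_vpath p H \<and> card (S \<inter> set p) \<ge> 3)"

definition gp :: "('a, 'b) pre_digraph \<Rightarrow> nat" where
  "gp H = Max {card S |S. general_position_set H S}"

definition independent_set :: "('a, 'b) pre_digraph \<Rightarrow> 'a set \<Rightarrow> bool" where
  "independent_set H S \<longleftrightarrow> S \<subseteq> verts H \<and> (\<forall>u\<in>S. \<forall>v\<in>S. (u, v) \<notin> arcs_ends H)"

definition independent_position_set :: "nat \<Rightarrow> ('a, 'b) pre_digraph \<Rightarrow> 'a set \<Rightarrow> bool" where
  "independent_position_set d H S \<longleftrightarrow> independent_set H S \<and>
     \<not> (\<exists>p. shortest_vpath p H \<and> vwalk_length p \<le> d \<and> card (S \<inter> set p) \<ge> 3)"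

definition ip :: "nat \<Rightarrow> ('a, 'b) pre_digraph \<Rightarrow> nat" where
  "ip d H = Max {card S |S. independent_position_set d H S}"

datatype 'a mycielskian_vertex = Orig 'a | Copy 'a | Root

definition mycielskian :: "'a pair_pre_digraph \<Rightarrow> 'a mycielskian_vertex pair_pre_digraph" where
  "mycielskian G = \<lparr>
     pverts = Orig ` pverts G \<union> Copy ` pverts G \<union> {Root},
     parcs = {(Orig u, Orig v) |u v. (u, v) \<in> parcs G}
       \<union> {(Orig u, Copy v) |u v. (u, v) \<in> parcs G}
       \<union> {(Copy u, Orig v) |u v. (u, v) \<in> parcs G}
       \<union> {(Copy v, Root) |v. v \<in> pverts G}
       \<union> {(Root, Copy v) |v. v \<in> pverts G} \<rparr>"

lemma pair_graph_mycielskian: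
  assumes "pair_graph G"
  shows "pair_graph (mycielskian G)"
proof -
  interpret pair_graph G by fact
  have "finite (pverts (mycielskian G))" (is "finite ?V")
    by (simp add: mycielskian_def)
  moreover have sub: "parcs (mycielskian G) \<subseteq> ?V \<times> ?V"
    by (auto simp: mycielskian_def dest: in_arcsD1 in_arcsD2)
  ultimately have fin: "finite (parcs (mycielskian G))"
    by (meson finite_SigmaI finite_subset)
  have sym: "sym (parcs (mycielskian G))"
    by (rule symI) (auto simp: mycielskian_def intro: arcs_symmetric)
  have loop: "fst e \<noteq> snd e" if "e \<in> parcs (mycielskian G)" for e
    using that by (auto simp: mycielskian_def dest: no_loops')
  show ?thesis
  proof unfold_locales
    show "symmetric (with_proj (mycielskian G))"
      using sym by (simp add: symmetric_def)
  qed (use \<open>finite ?V\<close> fin sub loop in auto)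
qed

end

theory Submission
  imports Defs
begin

text \<open>
  Let \<open>S\<close> be a largest general position set of the Mycielskian, \<open>A\<close> the set of original vertices in
  \<open>S\<close>, and \<open>B\<close> the set of vertices whose copies are in \<open>S\<close>. Almost all of the argument uses only
  that an induced path on three vertices is a shortest path, so it cannot lie inside \<open>S\<close>
  (\<open>general_position_set_no_induced_path\<close>).

  Suppose first that the root is not in \<open>S\<close>, so that
  \<open>card S = card (A \<union> B) + card (A \<inter> B)\<close>. The twin set \<open>A \<inter> B\<close> is an independent 4-position
  set of \<open>G\<close>: an edge \<open>uv\<close> inside it would give the induced path \<open>u, v, u'\<close>, and shortest paths of
  \<open>G\<close> of length at most 4 stay shortest in the Mycielskian, since a detour through the root costs at
  least 4 (\<open>shortest_vpath_map_Orig\<close>). Hence \<open>card (A \<inter> B)\<close> is at most the independent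
  4-position number. If some \<open>u\<close> lies in \<open>A \<inter> B\<close>, then no neighbour \<open>v\<close> of \<open>u\<close> is in \<open>A\<close>
  (path \<open>u, v, u'\<close>) and at most one is in \<open>B\<close> (path \<open>v', u, w'\<close>), so \<open>A \<union> B\<close> misses at least
  \<open>\<delta> - 1\<close> vertices. If \<open>A \<inter> B\<close> is empty, \<open>card S\<close> is at most the order of \<open>G\<close>.

  If the root is in \<open>S\<close>, then \<open>B\<close> has at most one element (path \<open>v', u\<^sup>*, w'\<close>). When \<open>B = {b}\<close>,
  no neighbour of \<open>b\<close> is in \<open>A\<close> (path \<open>u\<^sup>*, b', v\<close>), which gives
  \<open>card S \<le> n - \<delta> + 2\<close>, and a single vertex is an independent 4-position set. When \<open>B\<close> is empty,
  \<open>A\<close> is a proper subset of the vertices, because a connected non-complete graph contains an induced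
  path on three vertices; so \<open>card S \<le> n\<close>.
\<close>

section \<open>Adjacency in the Mycielskian\<close>

lemma mycielskian_arc_simps [simp]:
  "(Orig u, Orig v) \<in> parcs (mycielskian G) \<longleftrightarrow> (u, v) \<in> parcs G"
  "(Orig u, Copy v) \<in> parcs (mycielskian G) \<longleftrightarrow> (u, v) \<in> parcs G"
  "(Copy u, Orig v) \<in> parcs (mycielskian G) \<longleftrightarrow> (u, v) \<in> parcs G"
  "(Copy u, Copy v) \<notin> parcs (mycielskian G)"
  "(Copy v, Root) \<in> parcs (mycielskian G) \<longleftrightarrow> v \<in> pverts G"
  "(Root, Copy v) \<in> parcs (mycielskian G) \<longleftrightarrow> v \<in> pverts G"
  "(Orig v, Root) \<notin> parcs (mycielskian G)"
  "(Root, Orig v) \<notin> parcs (mycielskian G)"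
  "(Root, Root) \<notin> parcs (mycielskian G)"
  by (auto simp: mycielskian_def)

lemma mycielskian_vert_simps [simp]:
  "Orig v \<in> pverts (mycielskian G) \<longleftrightarrow> v \<in> pverts G"
  "Copy v \<in> pverts (mycielskian G) \<longleftrightarrow> v \<in> pverts G"
  "Root \<in> pverts (mycielskian G)"
  by (auto simp: mycielskian_def)

section \<open>General position sets and induced paths\<close>

lemma (in pair_loopfree_digraph) shortest_vpath_two_steps:
  assumes "(x, y) \<in> parcs G" "(y, z) \<in> parcs G" "x \<noteq> z" "(x, z) \<notin> parcs G"
  shows "shortest_vpath [x, y, z] (with_proj G)"
proof -
  have "vwalk_length [x, y, z] \<le> vwalk_length q"
    if q: "vpath q (with_proj G)" "hd q = x" "last q = z" for q
  proof (rule ccontr)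
    assume "\<not> ?thesis"
    moreover have "q \<noteq> []"
      using q(1) by (auto simp: vpath_def vwalk_def)
    ultimately have "length q = 1 \<or> length q = 2"
      by (cases q) (auto simp: not_le less_Suc_eq)
    then obtain a b where "q = [a] \<or> q = [a, b]"
      by (auto simp: length_Suc_conv numeral_2_eq_2)
    with q assms show False
      by (auto simp: vpath_def vwalk_def)
  qed
  moreover have "vpath [x, y, z] (with_proj G)"
    using assms no_loops'
    by (auto simp: vpath_def vwalk_def dest: in_arcsD1 in_arcsD2)
  ultimately show ?thesis
    by (simp add: shortest_vpath_def)
qed

text \<open>
  Stated as a closure property: for three members of the set that form a two-step path, the end
  vertices are adjacent. Below it is applied to pairs that are visibly non-adjacent in the
  Mycielskian.
\<close>

lemma (in pair_loopfree_digraph) general_position_set_no_induced_path: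
  assumes "general_position_set (with_proj G) S" "x \<in> S" "y \<in> S" "z \<in> S"
    and "(x, y) \<in> parcs G" "(y, z) \<in> parcs G" "x \<noteq> z"
  shows "(x, z) \<in> parcs G"
proof (rule ccontr)
  assume "(x, z) \<notin> parcs G"
  then have "shortest_vpath [x, y, z] (with_proj G)"
    using assms by (intro shortest_vpath_two_steps)
  moreover have "S \<inter> set [x, y, z] = {x, y, z}"
    using assms by auto
  moreover have "card {x, y, z} = 3"
    using assms no_loops' by auto
  ultimately show False
    using assms(1) unfolding general_position_set_def by (metis order_refl)
qed

section \<open>Short distances in the Mycielskian\<close>

primrec underlying :: "'a mycielskian_vertex \<Rightarrow> 'a" where
  "underlying (Orig v) = v"
| "underlying (Copy v) = v"
| "underlying Root = undefined"

text \<open>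
  Identifying each copy with its original maps edges to edges, so a detour through copies that avoids
  the root is no shorter than a walk in \<open>G\<close>.
\<close>

lemma vwalk_map_underlying:
  assumes "vwalk q (with_proj (mycielskian G))" "Root \<notin> set q"
  shows "vwalk (map underlying q) (with_proj G)"
  using assms
proof (induction q rule: vwalk_arcs.induct)
  case (2 x)
  then show ?case by (cases x) auto
next
  case (3 x y xs)
  then show ?case
    by (cases x; cases y) (auto simp: vwalk_def)
qed (simp add: vwalk_def)

text \<open>
  The root is adjacent to copies only, so a walk between original vertices needs at least two steps
  to reach it and two more to come back.
\<close>

lemma vwalk_through_root_length:
  assumes "vwalk q (with_proj (mycielskian G))" "Root \<in> set q"
    and "hd q = Orig a" "last q = Orig b"
  shows "length q \<ge> 5"
proof -
  obtain xs ys where q: "q = xs @ Root # ys"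
    using assms(2) by (meson split_list)
  have "length xs \<ge> 2"
  proof (rule ccontr)
    assume "\<not> ?thesis"
    then have "length xs = 0 \<or> length xs = 1" by linarith
    then show False
      using assms q by (auto simp: vwalk_def length_Suc_conv)
  qed
  moreover have "length ys \<ge> 2"
  proof (rule ccontr)
    assume "\<not> ?thesis"
    then have "ys = [] \<or> ys = [Orig b]"
      using assms(4) q by (cases ys) (auto simp: not_le)
    moreover have "vwalk (Root # ys) (with_proj (mycielskian G))"
      using assms(1) q by (auto intro: vwalkI_append_r)
    ultimately show False
      using assms(4) q by (auto simp: vwalk_def)
  qed
  ultimately show ?thesis using q by simp
qed

lemma length_vwalk_to_vpath: "length (vwalk_to_vpath p) \<le> length p"
  by (induction p rule: vwalk_to_vpath_induct3)
     (auto intro: order_trans[OF _ le_SucI[OF length_dropWhile_le]])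

text \<open>
  A competing path in the Mycielskian either meets the root, and then has length at least 4, or
  projects to a walk of the same length in \<open>G\<close>. The bound 4 is sharp: original vertices
  at greater distance in \<open>G\<close> are joined by a path of length 4 through the root.
\<close>

lemma shortest_vpath_map_Orig:
  assumes p: "shortest_vpath p (with_proj G)" and len: "vwalk_length p \<le> 4"
  shows "shortest_vpath (map Orig p) (with_proj (mycielskian G))"
proof -
  have vp: "vwalk p (with_proj G)" "distinct p" "p \<noteq> []"
    using p by (auto simp: shortest_vpath_def vpath_def vwalk_def)
  have "vwalk (map Orig p) (with_proj (mycielskian G))"
    using vp(1)
    by (induction p rule: vwalk_arcs.induct) (auto simp: vwalk_def)
  then have "vpath (map Orig p) (with_proj (mycielskian G))"
    using vp(2) by (simp add: vpath_def distinct_map inj_on_def)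
  moreover have "vwalk_length (map Orig p) \<le> vwalk_length q"
    if q: "vpath q (with_proj (mycielskian G))"
      and ends: "hd q = hd (map Orig p)" "last q = last (map Orig p)" for q
  proof (cases "Root \<in> set q")
    case True
    have "length q \<ge> 5"
      using True q ends vp(3) vwalk_through_root_length[of q G "hd p" "last p"]
      by (auto simp: vpath_def hd_map last_map)
    then show ?thesis using len by simp
  next
    case False
    let ?q = "vwalk_to_vpath (map underlying q)"
    have "q \<noteq> []" using q by (auto simp: vpath_def vwalk_def)
    then have "hd ?q = hd p" "last ?q = last p"
      using ends vp(3)
      by (simp_all add: vwalk_to_vpath_hd vwalk_to_vpath_last hd_map last_map)
    moreover have "vpath ?q (with_proj G)"
      using q False by (intro vwalk_to_vpath_vpath vwalk_map_underlying) (auto simp: vpath_def)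
    ultimately have "vwalk_length p \<le> vwalk_length ?q"
      using p by (simp add: shortest_vpath_def)
    then show ?thesis
      using length_vwalk_to_vpath[of "map underlying q"] by simp
  qed
  ultimately show ?thesis by (simp add: shortest_vpath_def)
qed

section \<open>Extremal sets and degrees\<close>

lemma (in pair_fin_digraph) card_le_ip:
  assumes "independent_position_set d (with_proj G) S"
  shows "card S \<le> ip d (with_proj G)"
proof -
  have "card T \<le> card (pverts G)" if "independent_position_set d (with_proj G) T" for T
    using that finite_verts
    by (auto simp: independent_position_set_def independent_set_def intro: card_mono)
  then have "{card S |S. independent_position_set d (with_proj G) S} \<subseteq> {..card (pverts G)}"
    by auto
  then have "finite {card S |S. independent_position_set d (with_proj G) S}"
    by (rule finite_subset) simp
  then show ?thesis
    unfolding ip_def using assms by (intro Max_ge) auto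
qed

lemma (in pair_loopfree_digraph) independent_position_set_singleton:
  assumes "u \<in> pverts G"
  shows "independent_position_set d (with_proj G) {u}"
proof -
  have "\<not> 3 \<le> card ({u} \<inter> X)" for X :: "'a set"
    by (cases "u \<in> X") auto
  then show ?thesis
    using assms no_loops'[of u u]
    by (auto simp: independent_position_set_def independent_set_def)
qed

lemma (in pair_fin_digraph) gp_attained:
  obtains S where "general_position_set (with_proj G) S" "gp (with_proj G) = card S"
proof -
  let ?C = "{card S |S. general_position_set (with_proj G) S}"
  have "card T \<le> card (pverts G)" if "general_position_set (with_proj G) T" for T
    using that finite_verts by (auto simp: general_position_set_def intro: card_mono)
  then have "?C \<subseteq> {..card (pverts G)}"
    by auto
  then have "finite ?C"
    by (rule finite_subset) simp
  moreover have "general_position_set (with_proj G) {}"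
    by (simp add: general_position_set_def)
  then have "?C \<noteq> {}" by auto
  ultimately have "gp (with_proj G) \<in> ?C"
    unfolding gp_def by (rule Max_in)
  then show thesis using that by auto
qed

lemma (in pair_fin_digraph) min_degree_le_card_neighbours:
  assumes "u \<in> pverts G"
  shows "min_degree (with_proj G) \<le> card {v. (u, v) \<in> parcs G}"
proof -
  have "min_degree (with_proj G) \<le> out_degree (with_proj G) u"
    unfolding min_degree_def using assms finite_verts by (intro Min_le) auto
  also have "out_arcs (with_proj G) u = Pair u ` {v. (u, v) \<in> parcs G}"
    by (auto simp: out_arcs_def)
  then have "out_degree (with_proj G) u = card {v. (u, v) \<in> parcs G}"
    unfolding out_degree_def by (simp add: card_image inj_on_def)
  finally show ?thesis .
qed

text \<open>
  Without an induced path on three vertices, being equal or adjacent is transitive, so all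
  vertices reachable from a vertex are equal or adjacent to it.
\<close>

lemma (in pair_graph) obtain_induced_path:
  assumes "Digraph_Component.connected (with_proj G)"
    and "\<not> complete_digraph (card (pverts G)) (with_proj G)"
  obtains x y z where "(x, y) \<in> parcs G" "(y, z) \<in> parcs G" "x \<noteq> z" "(x, z) \<notin> parcs G"
proof (rule ccontr)
  assume "\<not> thesis"
  with that have tr: "x = z \<or> (x, z) \<in> parcs G"
    if "(x, y) \<in> parcs G" "(y, z) \<in> parcs G" for x y z
    using that by blast
  have "u = v \<or> (u, v) \<in> parcs G" if "u \<in> pverts G" "v \<in> pverts G" for u v
  proof -
    have "u \<rightarrow>\<^sup>*\<^bsub>with_proj G\<^esub> v"
      using symmetric_connected_imp_strongly_connected[OF pair_sym_arcs assms(1)] that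
      by (auto simp: strongly_connected_def)
    then show ?thesis
      by (induction rule: reachable_induct) (use tr in auto)
  qed
  then have "parcs G = {(u, v). (u, v) \<in> pverts G \<times> pverts G \<and> u \<noteq> v}"
    by (auto dest: no_loops' in_arcsD1 in_arcsD2)
  then show False
    using assms(2) finite_verts by (simp add: complete_digraph_pair_def)
qed

section \<open>The size of general position sets of the Mycielskian\<close>

text \<open>
  Two adjacent vertices \<open>u\<close> and \<open>v\<close> of the set would give the induced path \<open>u, v, u'\<close> inside \<open>S\<close>.
  The condition on short shortest paths is inherited from the originals alone.
\<close>

lemma (in pair_graph) independent_position_set_twins:
  assumes S: "general_position_set (with_proj (mycielskian G)) S"
  shows "independent_position_set 4 (with_proj G) {v. Orig v \<in> S \<and> Copy v \<in> S}"
    (is "independent_position_set _ _ ?D")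
proof -
  interpret M: pair_graph "mycielskian G"
    by (rule pair_graph_mycielskian) (rule pair_graph)
  have verts: "?D \<subseteq> pverts G"
    using S by (auto simp: general_position_set_def)
  have "(u, v) \<notin> parcs G" if "u \<in> ?D" "v \<in> ?D" for u v
  proof
    assume uv: "(u, v) \<in> parcs G"
    have "(Orig u, Copy u) \<in> parcs (mycielskian G)"
      using M.general_position_set_no_induced_path[OF S, of "Orig u" "Orig v" "Copy u"] that uv arcs_symmetric[OF uv]
      by auto
    then show False using no_loops' by auto
  qed
  then have "independent_set (with_proj G) ?D"
    using verts by (auto simp: independent_set_def)
  moreover have False
    if p: "shortest_vpath p (with_proj G)" "vwalk_length p \<le> 4" "3 \<le> card (?D \<inter> set p)" for p
  proof -
    have "Orig ` (?D \<inter> set p) \<subseteq> S \<inter> set (map Orig p)" by auto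
    then have "card (Orig ` (?D \<inter> set p)) \<le> card (S \<inter> set (map Orig p))"
      by (intro card_mono) auto
    moreover have "card (Orig ` (?D \<inter> set p)) = card (?D \<inter> set p)"
      by (intro card_image) (simp add: inj_on_def)
    ultimately have "3 \<le> card (S \<inter> set (map Orig p))"
      using p(3) by linarith
    then show False
      using S shortest_vpath_map_Orig[OF p(1,2)] unfolding general_position_set_def by blast
  qed
  ultimately show ?thesis
    unfolding independent_position_set_def by blast
qed

lemma card_mycielskian_vertex_set:
  assumes "finite S" "Root \<notin> S"
  shows "card S = card {v. Orig v \<in> S} + card {v. Copy v \<in> S}"
    and "finite {v. Orig v \<in> S}" "finite {v. Copy v \<in> S}"
proof -
  have S: "S = Orig ` {v. Orig v \<in> S} \<union> Copy ` {v. Copy v \<in> S}" (is "S = ?O \<union> ?C")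
  proof -
    have "x \<in> ?O \<union> ?C" if "x \<in> S" for x
      using that assms(2) by (cases x) auto
    then show ?thesis by auto
  qed
  then have fin: "finite ?O" "finite ?C"
    using assms(1) by (metis finite_Un)+
  then show "finite {v. Orig v \<in> S}" "finite {v. Copy v \<in> S}"
    by (auto dest!: finite_imageD simp: inj_on_def)
  have "card S = card ?O + card ?C"
    using fin by (subst S, intro card_Un_disjoint) auto
  then show "card S = card {v. Orig v \<in> S} + card {v. Copy v \<in> S}"
    by (simp add: card_image inj_on_def)
qed

text \<open>
  Each vertex of \<open>G\<close> counts once if it or its copy is in \<open>S\<close>, and once more if both are. A vertex
  of the second kind pays for the surplus: at most one of its neighbours contributes to \<open>S\<close> at
  all.
\<close>

lemma (in pair_graph) card_general_position_set_without_root: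
  assumes S: "general_position_set (with_proj (mycielskian G)) S" and root: "Root \<notin> S"
  shows "int (card S) \<le> int (card (pverts G)) +
    max 0 (int (ip 4 (with_proj G)) - int (min_degree (with_proj G)) + 1)"
proof -
  interpret M: pair_graph "mycielskian G"
    by (rule pair_graph_mycielskian) (rule pair_graph)
  let ?A = "{v. Orig v \<in> S}" and ?B = "{v. Copy v \<in> S}"
  have verts: "?A \<union> ?B \<subseteq> pverts G" and "finite S"
    using S rev_finite_subset[OF M.pair_finite_verts, of S]
    by (auto simp: general_position_set_def)
  note parts = card_mycielskian_vertex_set[OF \<open>finite S\<close> root]
  have card_S: "card S = card (?A \<union> ?B) + card (?A \<inter> ?B)"
    using card_Un_Int[OF parts(2,3)] parts(1) by simp
  have twins: "card (?A \<inter> ?B) \<le> ip 4 (with_proj G)"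
    using card_le_ip[OF independent_position_set_twins[OF S]] by (simp add: Collect_conj_eq)
  show ?thesis
  proof (cases "?A \<inter> ?B = {}")
    case True
    then show ?thesis
      using card_S card_mono[OF pair_finite_verts verts] by simp
  next
    case False
    then obtain u where u: "Orig u \<in> S" "Copy u \<in> S" by auto
    let ?N = "{v. (u, v) \<in> parcs G}"
    have "v \<notin> ?A" if uv: "(u, v) \<in> parcs G" for v
    proof
      assume "v \<in> ?A"
      then have "(Orig u, Copy u) \<in> parcs (mycielskian G)"
        using M.general_position_set_no_induced_path[OF S, of "Orig u" "Orig v" "Copy u"] u uv arcs_symmetric[OF uv]
        by auto
      then show False using no_loops' by auto
    qed
    then have "?N \<inter> (?A \<union> ?B) = ?N \<inter> ?B" by auto
    moreover have "v = w" if "v \<in> ?N \<inter> ?B" "w \<in> ?N \<inter> ?B" for v w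
    proof (rule ccontr)
      assume "v \<noteq> w"
      then have "(Copy v, Copy w) \<in> parcs (mycielskian G)"
        using M.general_position_set_no_induced_path[OF S, of "Copy v" "Orig u" "Copy w"] that u arcs_symmetric[of u v]
        by auto
      then show False by simp
    qed
    moreover have finN: "finite ?N"
      using pair_finite_verts by (rule rev_finite_subset) (auto dest: in_arcsD2)
    ultimately have "card (?N \<inter> (?A \<union> ?B)) \<le> 1"
      by (simp add: card_le_Suc0_iff_eq)
    moreover have "card ?N + card (?A \<union> ?B) = card (?N \<union> (?A \<union> ?B)) + card (?N \<inter> (?A \<union> ?B))"
      using finN parts by (intro card_Un_Int) auto
    moreover have "card (?N \<union> (?A \<union> ?B)) \<le> card (pverts G)"
      using verts pair_finite_verts by (intro card_mono) (auto dest: in_arcsD2)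
    moreover have "min_degree (with_proj G) \<le> card ?N"
      using u verts by (intro min_degree_le_card_neighbours) auto
    ultimately show ?thesis using card_S twins by linarith
  qed
qed

text \<open>
  The root lies between any two copies and, through a copy \<open>b'\<close>, at distance two from the neighbours
  of \<open>b\<close>, so its presence leaves room for one copy only, and that copy excludes all those
  neighbours.
\<close>

lemma (in pair_graph) card_general_position_set_with_root:
  assumes S: "general_position_set (with_proj (mycielskian G)) S" and root: "Root \<in> S"
    and conn: "Digraph_Component.connected (with_proj G)"
    and noncomplete: "\<not> complete_digraph (card (pverts G)) (with_proj G)"
  shows "int (card S) \<le> int (card (pverts G)) +
    max 0 (int (ip 4 (with_proj G)) - int (min_degree (with_proj G)) + 1)"
proof -
  interpret M: pair_graph "mycielskian G"
    by (rule pair_graph_mycielskian) (rule pair_graph)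
  let ?A = "{v. Orig v \<in> S}" and ?B = "{v. Copy v \<in> S}"
  have verts: "?A \<subseteq> pverts G" "?B \<subseteq> pverts G" and "finite S"
    using S rev_finite_subset[OF M.pair_finite_verts, of S]
    by (auto simp: general_position_set_def)
  have card_S: "card S = card ?A + card ?B + 1"
    using card_mycielskian_vertex_set(1)[of "S - {Root}"] card.remove[OF \<open>finite S\<close> root]
      \<open>finite S\<close> by simp
  have B_eq: "v = w" if "v \<in> ?B" "w \<in> ?B" for v w
  proof (rule ccontr)
    assume "v \<noteq> w"
    then have "(Copy v, Copy w) \<in> parcs (mycielskian G)"
      using M.general_position_set_no_induced_path[OF S, of "Copy v" Root "Copy w"] that root verts
      by auto
    then show False by simp
  qed
  show ?thesis
  proof (cases "?B = {}")
    case True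
    obtain x y z where xyz: "(x, y) \<in> parcs G" "(y, z) \<in> parcs G" "x \<noteq> z" "(x, z) \<notin> parcs G"
      using obtain_induced_path[OF conn noncomplete] .
    have "?A \<noteq> pverts G"
    proof
      assume "?A = pverts G"
      then have "Orig v \<in> S" if "v \<in> pverts G" for v
        using that by auto
      then have "(Orig x, Orig z) \<in> parcs (mycielskian G)"
        using M.general_position_set_no_induced_path[OF S, of "Orig x" "Orig y" "Orig z"] xyz
        by (auto dest: in_arcsD1 in_arcsD2)
      then show False using xyz(4) by simp
    qed
    then have "card ?A < card (pverts G)"
      using verts pair_finite_verts by (intro psubset_card_mono) auto
    then show ?thesis
      using True card_S by simp
  next
    case False
    then obtain b where b: "Copy b \<in> S" by auto
    with B_eq have "?B = {b}" by auto
    let ?N = "{v. (b, v) \<in> parcs G}"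
    have "v \<notin> ?A" if "v \<in> ?N" for v
    proof
      assume "v \<in> ?A"
      then have "(Root, Orig v) \<in> parcs (mycielskian G)"
        using M.general_position_set_no_induced_path[OF S, of Root "Copy b" "Orig v"] that root b verts
        by auto
      then show False by simp
    qed
    then have "card ?A + card ?N = card (?A \<union> ?N)"
      using verts pair_finite_verts
      by (intro card_Un_disjoint[symmetric] rev_finite_subset[OF pair_finite_verts])
        (auto dest: in_arcsD2)
    also have "\<dots> \<le> card (pverts G)"
      using verts pair_finite_verts by (intro card_mono) (auto dest: in_arcsD2)
    finally have "card ?A + card ?N \<le> card (pverts G)" .
    moreover have "min_degree (with_proj G) \<le> card ?N"
      using b verts by (intro min_degree_le_card_neighbours) auto
    \<comment> \<open>The root and \<open>Copy b\<close> add 2 to \<open>card ?A\<close>; the bound allows the excess of 1 in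
      \<open>- \<delta> + 1\<close> and the independent 4-position number supplies the other.\<close>
    moreover have "1 \<le> ip 4 (with_proj G)"
      using card_le_ip[OF independent_position_set_singleton, of b 4] b verts by auto
    ultimately show ?thesis
      using card_S \<open>?B = {b}\<close> by simp
  qed
qed

theorem theorem17:
  fixes G :: "'a pair_pre_digraph" and n \<delta> :: nat
  assumes "pair_graph G"
    and "Digraph_Component.connected (with_proj G)"
    and "card (pverts G) = n"
    and "\<not> complete_digraph n (with_proj G)"
    and "min_degree (with_proj G) = \<delta>"
    and "\<delta> \<ge> 1"
  shows "int (gp (with_proj (mycielskian G))) \<le> int n + max 0 (int (ip 4 (with_proj G)) - int \<delta> + 1)"
proof -
  interpret pair_graph G by fact
  interpret M: pair_graph "mycielskian G"
    by (rule pair_graph_mycielskian) fact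
  obtain S where S: "general_position_set (with_proj (mycielskian G)) S"
    and gp: "gp (with_proj (mycielskian G)) = card S"
    by (rule M.gp_attained)
  show ?thesis
  proof (cases "Root \<in> S")
    case True
    then show ?thesis
      using card_general_position_set_with_root[OF S] assms gp by simp
  next
    case False
    then show ?thesis
      using card_general_position_set_without_root[OF S] assms gp by simp
  qed
qed

end
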